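(* For every formula $\varphi$ of $\mathcal R\text{Ł}$ there exist an increasing sequence $(\alpha_n)_n$ of rational formulas and a decreasing sequence $(\beta_n)_n$ of rational formulas such that $\varphi=\lim_n\alpha_n=\lim_n\beta_n$.
   Context: The logic $\mathcal R\text{Ł}$: formulas are built from propositional variables $v_1,v_2,\dots$ with connectives $\neg$, $\rightarrow$ and unary connectives $\nabla_r$, $r\in[0,1]$. Abbreviations: $\varphi\vee\psi=(\varphi\to\psi)\to\psi$, $\varphi\&\psi=\neg(\varphi\to\neg\psi)$, $\varphi\leftrightarrow\psi=(\varphi\to\psi)\&(\psi\to\varphi)$, $\Delta_r\varphi=\neg\nabla_r\neg\varphi$. For reals $r,q\in[0,1]$, $r\odot q^*=\max(0,r-q)$. Axioms: (L1) $\varphi\to(\psi\to\varphi)$; (L2) $(\varphi\to\psi)\to((\psi\to\chi)\to(\varphi\to\chi))$; (L3) $(\varphi\vee\psi)\to(\psi\vee\varphi)$; (L4) $(\neg\psi\to\neg\varphi)\to(\varphi\to\psi)$; (R1) $\nabla_r(\varphi\to\psi)\leftrightarrow(\nabla_r\varphi\to\nabla_r\psi)$; (R2) $\nabla_{r\odot q^*}\varphi\leftrightarrow(\nabla_q\varphi\to\nabla_r\varphi)$; (R3) $\nabla_r(\nabla_q\varphi)\leftrightarrow\nabla_{rq}\varphi$; (R4) $\nabla_1\varphi\leftrightarrow\varphi$. The only rule is modus ponens; $\vdash\varphi$ means $\varphi$ is derivable from the axioms. A formula is rational if every connective $\nabla_q$ occurring in it has $q\in[0,1]\cap\mathbb Q$.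 A sequence $(\varphi_n)_n$ of formulas is increasing if $\vdash\varphi_n\to\varphi_{n+1}$ for all $n$, and decreasing if $\vdash\varphi_{n+1}\to\varphi_n$ for all $n$. A $[0,1]$-evaluation $e$ satisfies $e(\neg\varphi)=1-e(\varphi)$, $e(\varphi\to\psi)=\min(1,1-e(\varphi)+e(\psi))$, $e(\nabla_r\varphi)=1-r(1-e(\varphi))$. The term function $f_\varphi$ maps a $[0,1]$-valued assignment to the variables to the resulting value of $\varphi$. $\varphi=\lim_n\varphi_n$ means: $(f_{\varphi_n})_n$ converges uniformly to $f_\varphi$; equivalently, for a fixed theorem $\eta$ of $\mathcal R\text{Ł}$, for every $r\in[0,1)$ there is $k$ such that $\vdash\Delta_r\eta\to(\varphi\leftrightarrow\varphi_n)$ for all $n\ge k$. *)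

theory Defs
  imports "HOL-Analysis.Uniform_Limit"
begin

section \<open>Formulas\<close>

typedef unit_real = "{0..1::real}"
  morphisms real_of_unit unit_of_real
  by (rule exI[of _ 0]) simp

setup_lifting type_definition_unit_real

lift_definition unit_one :: unit_real is "1::real"
  by simp

lift_definition unit_times :: "unit_real \<Rightarrow> unit_real \<Rightarrow> unit_real" is "\<lambda>r q. r * q"
  by (simp add: mult_le_one)

text \<open>The truncated difference \<open>r \<odot> q\<^sup>* = max(0, r - q)\<close>.\<close>

lift_definition unit_diff :: "unit_real \<Rightarrow> unit_real \<Rightarrow> unit_real" is "\<lambda>r q. max 0 (r - q)"
  by auto

text \<open>\<open>Var i\<close> is the variable \<open>v\<^bsub>i+1\<^esub>\<close>.\<close>

datatype form =
    Var nat
  | Neg form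
  | Imp form form  (infixr "\<rightarrow>\<^sub>L" 55)
  | Nabla unit_real form

abbreviation Or :: "form \<Rightarrow> form \<Rightarrow> form" where
  "Or \<phi> \<psi> \<equiv> (\<phi> \<rightarrow>\<^sub>L \<psi>) \<rightarrow>\<^sub>L \<psi>"

abbreviation Conj :: "form \<Rightarrow> form \<Rightarrow> form" where
  "Conj \<phi> \<psi> \<equiv> Neg (\<phi> \<rightarrow>\<^sub>L Neg \<psi>)"

abbreviation Iff :: "form \<Rightarrow> form \<Rightarrow> form" where
  "Iff \<phi> \<psi> \<equiv> Conj (\<phi> \<rightarrow>\<^sub>L \<psi>) (\<psi> \<rightarrow>\<^sub>L \<phi>)"

primrec rational_form :: "form \<Rightarrow> bool" where
  "rational_form (Var i) \<longleftrightarrow> True"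
| "rational_form (Neg \<phi>) \<longleftrightarrow> rational_form \<phi>"
| "rational_form (\<phi> \<rightarrow>\<^sub>L \<psi>) \<longleftrightarrow> rational_form \<phi> \<and> rational_form \<psi>"
| "rational_form (Nabla q \<phi>) \<longleftrightarrow> real_of_unit q \<in> \<rat> \<and> rational_form \<phi>"

section \<open>Derivability\<close>

inductive derivable :: "form \<Rightarrow> bool"  ("\<turnstile> _" [50] 50) where
  L1: "\<turnstile> \<phi> \<rightarrow>\<^sub>L (\<psi> \<rightarrow>\<^sub>L \<phi>)"
| L2: "\<turnstile> (\<phi> \<rightarrow>\<^sub>L \<psi>) \<rightarrow>\<^sub>L ((\<psi> \<rightarrow>\<^sub>L \<theta>) \<rightarrow>\<^sub>L (\<phi> \<rightarrow>\<^sub>L \<theta>))"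
| L3: "\<turnstile> Or \<phi> \<psi> \<rightarrow>\<^sub>L Or \<psi> \<phi>"
| L4: "\<turnstile> (Neg \<psi> \<rightarrow>\<^sub>L Neg \<phi>) \<rightarrow>\<^sub>L (\<phi> \<rightarrow>\<^sub>L \<psi>)"
| R1: "\<turnstile> Iff (Nabla r (\<phi> \<rightarrow>\<^sub>L \<psi>)) (Nabla r \<phi> \<rightarrow>\<^sub>L Nabla r \<psi>)"
| R2: "\<turnstile> Iff (Nabla (unit_diff r q) \<phi>) (Nabla q \<phi> \<rightarrow>\<^sub>L Nabla r \<phi>)"
| R3: "\<turnstile> Iff (Nabla r (Nabla q \<phi>)) (Nabla (unit_times r q) \<phi>)"
| R4: "\<turnstile> Iff (Nabla unit_one \<phi>) \<phi>"
| MP: "\<turnstile> \<phi> \<Longrightarrow> \<turnstile> \<phi> \<rightarrow>\<^sub>L \<psi> \<Longrightarrow> \<turnstile> \<psi>"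

definition increasing_forms :: "(nat \<Rightarrow> form) \<Rightarrow> bool" where
  "increasing_forms \<Phi> \<longleftrightarrow> (\<forall>n. \<turnstile> \<Phi> n \<rightarrow>\<^sub>L \<Phi> (Suc n))"

definition decreasing_forms :: "(nat \<Rightarrow> form) \<Rightarrow> bool" where
  "decreasing_forms \<Phi> \<longleftrightarrow> (\<forall>n. \<turnstile> \<Phi> (Suc n) \<rightarrow>\<^sub>L \<Phi> n)"

section \<open>Term functions and limits\<close>

definition assignments :: "(nat \<Rightarrow> real) set" where
  "assignments = {e. \<forall>i. e i \<in> {0..1}}"

text \<open>The term function of \<open>\<phi>\<close>; only its values on \<open>assignments\<close> are meaningful.\<close>

primrec term_fun :: "form \<Rightarrow> (nat \<Rightarrow> real) \<Rightarrow> real" where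
  "term_fun (Var i) e = e i"
| "term_fun (Neg \<phi>) e = 1 - term_fun \<phi> e"
| "term_fun (\<phi> \<rightarrow>\<^sub>L \<psi>) e = min 1 (1 - term_fun \<phi> e + term_fun \<psi> e)"
| "term_fun (Nabla r \<phi>) e = 1 - real_of_unit r * (1 - term_fun \<phi> e)"

definition form_lim :: "(nat \<Rightarrow> form) \<Rightarrow> form \<Rightarrow> bool" where
  "form_lim \<Phi> \<phi> \<longleftrightarrow>
     uniform_limit assignments (\<lambda>n. term_fun (\<Phi> n)) (term_fun \<phi>) sequentially"

end

theory Submission
  imports Defs
begin

text \<open>
  The connectives are monotone or antitone in each argument and, by (R2), \<open>\<nabla>\<^sub>r \<phi>\<close> is antitone
  in the index \<open>r\<close>; all of this is derivable. Hence replacing each index of \<open>\<phi>\<close>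
  by dyadic rationals approaching it from one side, the side being determined by the
  polarity of the occurrence, yields derivably monotone sequences of rational formulas, which
  converge since the term functions depend uniformly continuously on the indices.
\<close>

section \<open>Derivations\<close>

lemma derivable_trans:
  assumes "\<turnstile> \<phi> \<rightarrow>\<^sub>L \<psi>" and "\<turnstile> \<psi> \<rightarrow>\<^sub>L \<theta>"
  shows "\<turnstile> \<phi> \<rightarrow>\<^sub>L \<theta>"
  using MP[OF assms(2) MP[OF assms(1) L2]] .

text \<open>By (L1), \<phi> implies \<open>Or \<psi> \<phi>\<close>; (L3) swaps this into
  \<open>Or \<phi> \<psi>\<close>, which unfolds to the conclusion.\<close>

lemma derivable_assertion: "\<turnstile> \<phi> \<rightarrow>\<^sub>L ((\<phi> \<rightarrow>\<^sub>L \<psi>) \<rightarrow>\<^sub>L \<psi>)"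
  using derivable_trans[OF L1 L3] .

text \<open>(L2) turns the premise into \<open>((\<psi> \<rightarrow>\<^sub>L \<theta>)
  \<rightarrow>\<^sub>L \<theta>) \<rightarrow>\<^sub>L (\<phi> \<rightarrow>\<^sub>L
  \<theta>)\<close>; prefixing assertion for \<psi> replaces the antecedent by \<psi>.\<close>

lemma derivable_exchange: "\<turnstile> (\<phi> \<rightarrow>\<^sub>L (\<psi> \<rightarrow>\<^sub>L \<theta>)) \<rightarrow>\<^sub>L (\<psi> \<rightarrow>\<^sub>L (\<phi> \<rightarrow>\<^sub>L \<theta>))"
  using derivable_trans[OF L2 MP[OF derivable_assertion L2]] .

lemma derivable_refl: "\<turnstile> \<phi> \<rightarrow>\<^sub>L \<phi>"
  using MP[OF L1 MP[OF L1 derivable_exchange]] .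

lemma derivable_double_neg_elim: "\<turnstile> Neg (Neg \<phi>) \<rightarrow>\<^sub>L \<phi>"
proof -
  \<comment> \<open>Any theorem would serve as \<open>?\<eta>\<close>: it is a spare antecedent,
    discharged at the end by exchange and modus ponens.\<close>
  let ?\<eta> = "\<phi> \<rightarrow>\<^sub>L \<phi>"
  \<comment> \<open>(L1) adds the antecedent \<open>Neg (Neg ?\<eta>)\<close>; two uses of (L4) then
    strip the double negations from both sides.\<close>
  have "\<turnstile> Neg (Neg \<phi>) \<rightarrow>\<^sub>L (?\<eta> \<rightarrow>\<^sub>L \<phi>)"
    using derivable_trans[OF derivable_trans[OF L1 L4] L4] .
  then show ?thesis
    using MP[OF derivable_refl MP[OF _ derivable_exchange]] by blast
qed

lemma derivable_double_neg_intro: "\<turnstile> \<phi> \<rightarrow>\<^sub>L Neg (Neg \<phi>)"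
  using MP[OF derivable_double_neg_elim L4] .

lemma derivable_contrapos:
  assumes "\<turnstile> \<phi> \<rightarrow>\<^sub>L \<psi>"
  shows "\<turnstile> Neg \<psi> \<rightarrow>\<^sub>L Neg \<phi>"
  using MP[OF derivable_trans[OF derivable_trans[OF derivable_double_neg_elim assms]
        derivable_double_neg_intro] L4] .

lemma derivable_Conj1: "\<turnstile> Conj \<phi> \<psi> \<rightarrow>\<^sub>L \<phi>"
proof -
  have "\<turnstile> Neg \<phi> \<rightarrow>\<^sub>L (\<phi> \<rightarrow>\<^sub>L Neg \<psi>)"
    using derivable_trans[OF L1 L4] .
  then show ?thesis
    using derivable_trans[OF derivable_contrapos derivable_double_neg_elim] by blast
qed

lemma derivable_Conj2: "\<turnstile> Conj \<phi> \<psi> \<rightarrow>\<^sub>L \<psi>"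
  using derivable_trans[OF derivable_contrapos[OF L1] derivable_double_neg_elim] .

lemma derivable_IffD1: "\<turnstile> Iff \<phi> \<psi> \<Longrightarrow> \<turnstile> \<phi> \<rightarrow>\<^sub>L \<psi>"
  by (rule MP[OF _ derivable_Conj1])

lemma derivable_IffD2: "\<turnstile> Iff \<phi> \<psi> \<Longrightarrow> \<turnstile> \<psi> \<rightarrow>\<^sub>L \<phi>"
  by (rule MP[OF _ derivable_Conj2])

lemma derivable_Imp_mono:
  assumes "\<turnstile> \<phi>' \<rightarrow>\<^sub>L \<phi>" and "\<turnstile> \<psi> \<rightarrow>\<^sub>L \<psi>'"
  shows "\<turnstile> (\<phi> \<rightarrow>\<^sub>L \<psi>) \<rightarrow>\<^sub>L (\<phi>' \<rightarrow>\<^sub>L \<psi>')"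
  using derivable_trans[OF MP[OF assms(1) L2] MP[OF assms(2) MP[OF L2 derivable_exchange]]] .

text \<open>For \<open>p\<close> at most \<open>q\<close> the truncated difference is 0, so (R2)
  reduces the claim to \<open>Nabla\<close> with index 0 being a theorem. That is (R2) again, with
  both indices equal to \<open>q\<close>, applied to reflexivity.\<close>

lemma derivable_Nabla_antimono:
  assumes "real_of_unit p \<le> real_of_unit q"
  shows "\<turnstile> Nabla q \<phi> \<rightarrow>\<^sub>L Nabla p \<phi>"
proof -
  have diff: "unit_diff p q = unit_diff q q"
    using assms by transfer simp
  have "\<turnstile> Nabla (unit_diff q q) \<phi>"
    using MP[OF derivable_refl derivable_IffD2[OF R2]] .
  then show ?thesis
    using MP[OF _ derivable_IffD1[OF R2, of p q \<phi>]] unfolding diff by blast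
qed

text \<open>(R4) gives the case of index 1, the largest index; antitonicity in the index passes to
  \<open>r\<close>.\<close>

lemma derivable_necessitation:
  assumes "\<turnstile> \<phi>"
  shows "\<turnstile> Nabla r \<phi>"
proof -
  have "real_of_unit r \<le> real_of_unit unit_one"
    by transfer simp
  then show ?thesis
    using MP[OF MP[OF assms derivable_IffD2[OF R4]] derivable_Nabla_antimono] by blast
qed

text \<open>First lower the index from \<open>p\<close> to \<open>q\<close>, then distribute
  \<open>Nabla q\<close> over the implication by (R1).\<close>

lemma derivable_Nabla_mono:
  assumes "real_of_unit q \<le> real_of_unit p" and "\<turnstile> \<phi> \<rightarrow>\<^sub>L \<psi>"
  shows "\<turnstile> Nabla p \<phi> \<rightarrow>\<^sub>L Nabla q \<psi>"
  using derivable_trans[OF derivable_Nabla_antimono[OF assms(1)]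
      MP[OF derivable_necessitation[OF assms(2)] derivable_IffD1[OF R1]]] .

section \<open>Limits\<close>

lemma term_fun_bounds:
  assumes "e \<in> assignments"
  shows "term_fun \<phi> e \<in> {0..1}"
proof (induction \<phi>)
  case (Nabla r \<phi>)
  have "real_of_unit r * (1 - term_fun \<phi> e) \<in> {0..1}"
    using Nabla real_of_unit[of r] by (auto intro!: mult_le_one)
  then show ?case by auto
qed (use assms in \<open>auto simp: assignments_def\<close>)

lemma form_lim_Neg: "form_lim \<Phi> \<phi> \<Longrightarrow> form_lim (\<lambda>n. Neg (\<Phi> n)) (Neg \<phi>)"
  unfolding form_lim_def term_fun.simps
  by (intro uniform_limit_intros)

lemma form_lim_Imp:
  assumes "form_lim \<Phi> \<phi>" and "form_lim \<Psi> \<psi>"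
  shows "form_lim (\<lambda>n. \<Phi> n \<rightarrow>\<^sub>L \<Psi> n) (\<phi> \<rightarrow>\<^sub>L \<psi>)"
proof -
  have lim: "uniform_limit assignments (\<lambda>n e. 1 - term_fun (\<Phi> n) e + term_fun (\<Psi> n) e)
      (\<lambda>e. 1 - term_fun \<phi> e + term_fun \<psi> e) sequentially"
    using assms unfolding form_lim_def by (intro uniform_limit_intros)
  \<comment> \<open>Truncation at 1 is nonexpansive, so it preserves the uniform limit
    \<open>lim\<close>.\<close>
  have contraction: "dist (min 1 x) (min 1 y) \<le> dist x y" for x y :: real
    by (auto simp: dist_real_def min_def)
  show ?thesis
    unfolding form_lim_def term_fun.simps
    by (rule metric_uniform_limit_imp_uniform_limit[OF lim]) (simp add: contraction)
qed

lemma form_lim_Nabla: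
  assumes "form_lim \<Phi> \<phi>" and "(\<lambda>n. real_of_unit (q n)) \<longlonglongrightarrow> real_of_unit r"
  shows "form_lim (\<lambda>n. Nabla (q n) (\<Phi> n)) (Nabla r \<phi>)"
proof -
  have "uniform_limit assignments (\<lambda>n e. real_of_unit (q n)) (\<lambda>e. real_of_unit r) sequentially"
    using assms(2) by (auto simp: uniform_limit_iff tendsto_iff)
  moreover have "uniform_limit assignments (\<lambda>n e. 1 - term_fun (\<Phi> n) e)
      (\<lambda>e. 1 - term_fun \<phi> e) sequentially"
    using assms(1) unfolding form_lim_def by (intro uniform_limit_intros)
  \<comment> \<open>Products preserve uniform convergence when both limit functions are
    bounded.\<close>
  moreover have "bounded ((\<lambda>e. real_of_unit r) ` assignments)"
    by (rule bounded_subset[of "{real_of_unit r}"]) auto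
  moreover have "bounded ((\<lambda>e. 1 - term_fun \<phi> e) ` assignments)"
    by (rule boundedI[of _ 1]) (use term_fun_bounds in auto)
  ultimately show ?thesis
    unfolding form_lim_def term_fun.simps
    by (rule uniform_limit_minus[OF uniform_limit_const uniform_lim_mult])
qed

section \<open>Rational approximation of the indices\<close>

lemma rational_approx_below:
  fixes r :: real
  assumes "r \<in> {0..1}"
  obtains p where "\<And>n. p n \<in> {0..1}" "\<And>n. p n \<in> \<rat>" "incseq p" "p \<longlonglongrightarrow> r"
proof -
  define p :: "nat \<Rightarrow> real" where "p n = of_int \<lfloor>r * 2 ^ n\<rfloor> / 2 ^ n" for n
  \<comment> \<open>Rounding down costs at most 1 before the division by
    \<open>2 ^ n\<close>.\<close>
  have upper: "p n \<le> r" and lower: "r - (1/2) ^ n \<le> p n" for n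
  proof -
    have "of_int \<lfloor>r * 2 ^ n\<rfloor> \<le> r * 2 ^ n" "r * 2 ^ n - 1 \<le> of_int \<lfloor>r * 2 ^ n\<rfloor>"
      by linarith+
    moreover have "r - (1/2) ^ n = (r * 2 ^ n - 1) / 2 ^ n"
      by (simp add: power_one_over diff_divide_distrib)
    ultimately show "p n \<le> r" "r - (1/2) ^ n \<le> p n"
      by (simp_all add: p_def divide_right_mono pos_divide_le_eq)
  qed
  show ?thesis
  proof (rule that)
    show "p n \<in> \<rat>" for n
      by (simp add: p_def)
    show "p n \<in> {0..1}" for n
    proof -
      have "0 \<le> p n"
        using assms by (simp add: p_def)
      moreover have "p n \<le> 1"
        using assms upper[of n] by simp
      ultimately show ?thesis by simp
    qed
    show "incseq p"
    proof (rule incseq_SucI)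
      fix n
      \<comment> \<open>Each dyadic grid refines the previous one, so rounding down on the finer
        grid cannot give less.\<close>
      have "2 * \<lfloor>r * 2 ^ n\<rfloor> \<le> \<lfloor>2 * (r * 2 ^ n)\<rfloor>"
        by linarith
      then have "2 * real_of_int \<lfloor>r * 2 ^ n\<rfloor> \<le> of_int \<lfloor>r * 2 ^ Suc n\<rfloor>"
        by (simp add: mult.left_commute)
      then show "p n \<le> p (Suc n)"
        by (simp add: p_def field_simps)
    qed
    have "(\<lambda>n. r - (1/2) ^ n) \<longlonglongrightarrow> r - 0"
      by (intro tendsto_intros LIMSEQ_realpow_zero) auto
    then show "p \<longlonglongrightarrow> r"
      by (intro tendsto_sandwich[of "\<lambda>n. r - (1/2) ^ n" p sequentially "\<lambda>n. r"])
        (use upper lower in auto)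
  qed
qed

lemma unit_approx_below:
  obtains p where "\<And>n. real_of_unit (p n) \<in> \<rat>" "\<And>n. real_of_unit (p n) \<le> real_of_unit (p (Suc n))"
    "(\<lambda>n. real_of_unit (p n)) \<longlonglongrightarrow> real_of_unit r"
proof -
  obtain p where p: "\<And>n. p n \<in> {0..1}" "\<And>n. p n \<in> \<rat>" "incseq p" "p \<longlonglongrightarrow> real_of_unit r"
    using rational_approx_below[OF real_of_unit] by blast
  then show ?thesis
    by (intro that[of "\<lambda>n. unit_of_real (p n)"]) (simp_all add: unit_of_real_inverse incseq_SucD)
qed

text \<open>Approximating \<open>1 - real_of_unit r\<close> from below and reflecting by
  \<open>1 - x\<close> keeps the values rational and inside the unit interval.\<close>

lemma unit_approx_above:
  obtains q where "\<And>n. real_of_unit (q n) \<in> \<rat>" "\<And>n. real_of_unit (q (Suc n)) \<le> real_of_unit (q n)"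
    "(\<lambda>n. real_of_unit (q n)) \<longlonglongrightarrow> real_of_unit r"
proof -
  have "1 - real_of_unit r \<in> {0..1}"
    using real_of_unit[of r] by auto
  then obtain p where p: "\<And>n. p n \<in> {0..1}" "\<And>n. p n \<in> \<rat>" "incseq p"
      "p \<longlonglongrightarrow> 1 - real_of_unit r"
    using rational_approx_below by blast
  have inverse: "real_of_unit (unit_of_real (1 - p n)) = 1 - p n" for n
    using p(1)[of n] by (intro unit_of_real_inverse) auto
  have "(\<lambda>n. 1 - p n) \<longlonglongrightarrow> 1 - (1 - real_of_unit r)"
    by (intro tendsto_intros p(4))
  then show ?thesis
    by (intro that[of "\<lambda>n. unit_of_real (1 - p n)"])
      (simp_all add: inverse p(2) incseq_SucD[OF p(3)])
qed

theorem theorem2p12: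
  fixes \<phi> :: form
  shows "\<exists>\<alpha> \<beta>.
    increasing_forms \<alpha> \<and> (\<forall>n. rational_form (\<alpha> n)) \<and>
    decreasing_forms \<beta> \<and> (\<forall>n. rational_form (\<beta> n)) \<and>
    form_lim \<alpha> \<phi> \<and> form_lim \<beta> \<phi>"
proof (induction \<phi>)
  case (Var i)
  have "increasing_forms (\<lambda>n. Var i)" "decreasing_forms (\<lambda>n. Var i)"
    by (simp_all add: increasing_forms_def decreasing_forms_def derivable_refl)
  moreover have "form_lim (\<lambda>n. Var i) (Var i)"
    by (simp add: form_lim_def uniform_limit_const)
  ultimately show ?case
    by (intro exI[of _ "\<lambda>n. Var i"]) simp
next
  case (Neg \<phi>)
  then obtain \<alpha> \<beta> where "increasing_forms \<alpha>" "\<forall>n. rational_form (\<alpha> n)" "form_lim \<alpha> \<phi>"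
      "decreasing_forms \<beta>" "\<forall>n. rational_form (\<beta> n)" "form_lim \<beta> \<phi>"
    by blast
  then show ?case
    \<comment> \<open>Negation is antitone, so the two sequences trade places; this is why the
      induction carries both at once.\<close>
    by (intro exI[of _ "\<lambda>n. Neg (\<beta> n)"] exI[of _ "\<lambda>n. Neg (\<alpha> n)"])
      (simp add: increasing_forms_def decreasing_forms_def derivable_contrapos form_lim_Neg)
next
  case (Imp \<phi> \<psi>)
  from Imp(1) obtain \<alpha> \<beta> where "increasing_forms \<alpha>" "\<forall>n. rational_form (\<alpha> n)" "form_lim \<alpha> \<phi>"
      "decreasing_forms \<beta>" "\<forall>n. rational_form (\<beta> n)" "form_lim \<beta> \<phi>"
    by blast
  moreover from Imp(2) obtain \<gamma> \<delta> where
      "increasing_forms \<gamma>" "\<forall>n. rational_form (\<gamma> n)" "form_lim \<gamma> \<psi>"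
      "decreasing_forms \<delta>" "\<forall>n. rational_form (\<delta> n)" "form_lim \<delta> \<psi>"
    by blast
  ultimately show ?case
    \<comment> \<open>Only the antecedent is antitone: the increasing sequence takes \<beta> on the
      left and \<gamma> on the right.\<close>
    by (intro exI[of _ "\<lambda>n. \<beta> n \<rightarrow>\<^sub>L \<gamma> n"] exI[of _ "\<lambda>n. \<alpha> n \<rightarrow>\<^sub>L \<delta> n"])
      (simp add: increasing_forms_def decreasing_forms_def derivable_Imp_mono form_lim_Imp)
next
  case (Nabla r \<phi>)
  then obtain \<alpha> \<beta> where "increasing_forms \<alpha>" "\<forall>n. rational_form (\<alpha> n)" "form_lim \<alpha> \<phi>"
      "decreasing_forms \<beta>" "\<forall>n. rational_form (\<beta> n)" "form_lim \<beta> \<phi>"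
    by blast
  moreover obtain p where "\<And>n. real_of_unit (p n) \<in> \<rat>"
      "\<And>n. real_of_unit (p n) \<le> real_of_unit (p (Suc n))"
      "(\<lambda>n. real_of_unit (p n)) \<longlonglongrightarrow> real_of_unit r"
    using unit_approx_below by blast
  moreover obtain q where "\<And>n. real_of_unit (q n) \<in> \<rat>"
      "\<And>n. real_of_unit (q (Suc n)) \<le> real_of_unit (q n)"
      "(\<lambda>n. real_of_unit (q n)) \<longlonglongrightarrow> real_of_unit r"
    using unit_approx_above by blast
  ultimately show ?case
    \<comment> \<open>Shrinking indices strengthen the growth of \<alpha>, hence \<open>q\<close>
      goes with \<alpha> and the growing \<open>p\<close> with \<beta>.\<close>
    by (intro exI[of _ "\<lambda>n. Nabla (q n) (\<alpha> n)"] exI[of _ "\<lambda>n. Nabla (p n) (\<beta> n)"])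
      (simp add: increasing_forms_def decreasing_forms_def derivable_Nabla_mono form_lim_Nabla)
qed

end
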